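(* Let $ABC$ be the excentral triangle of a triangle $H_1H_2H_3$, so that $H_1,H_2,H_3$ are the feet of the altitudes of $ABC$. Let $\mathcal{K}$ be the Darboux cubic of the triangle $H_1H_2H_3$. Then $\mathcal{K}$ passes through the vertices $A,B,C$, the feet of the altitudes $H_1,H_2,H_3$, the orthocenter, the Euler center (nine-point center), and the circumcenter of $ABC$.
   Context: The Darboux cubic of a triangle is the cubic curve passing through its vertices, its excenters, its incenter, its circumcenter and its Bevan point (it is the locus of points $P$ such that $P$, its isogonal conjugate, and the de Longchamps point are collinear). The Bevan point of a triangle is the circumcenter of its excentral triangle; the de Longchamps point is the reflection of the orthocenter in the circumcenter. The excentral triangle of a triangle has as vertices its three excenters. *)

theory Defs
  imports "HOL-Analysis.Analysis"
begin

type_synonym point = "real^2"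

subsection \<open>Triangle centres\<close>

text \<open>The first argument is the vertex of the angle, the other two are points on its legs.
  Since \<^term>\<open>sgn\<close> normalises a vector, the sum and the difference of the two unit vectors
  along the legs are direction vectors of the bisectors.\<close>

definition internal_bisector :: "point \<Rightarrow> point \<Rightarrow> point \<Rightarrow> point set" where
  "internal_bisector A B C = {A + t *\<^sub>R (sgn (B - A) + sgn (C - A)) | t. True}"

definition external_bisector :: "point \<Rightarrow> point \<Rightarrow> point \<Rightarrow> point set" where
  "external_bisector A B C = {A + t *\<^sub>R (sgn (B - A) - sgn (C - A)) | t. True}"

definition incenter :: "point \<Rightarrow> point \<Rightarrow> point \<Rightarrow> point" where
  "incenter A B C = (THE P. P \<in> internal_bisector A B C \<and> P \<in> internal_bisector B C A \<and>
      P \<in> internal_bisector C A B)"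

text \<open>The excenter opposite to the first argument.\<close>

definition excenter :: "point \<Rightarrow> point \<Rightarrow> point \<Rightarrow> point" where
  "excenter A B C = (THE P. P \<in> internal_bisector A B C \<and> P \<in> external_bisector B C A \<and>
      P \<in> external_bisector C A B)"

definition circumcenter :: "point \<Rightarrow> point \<Rightarrow> point \<Rightarrow> point" where
  "circumcenter A B C = (THE P. dist P A = dist P B \<and> dist P B = dist P C)"

definition orthocenter :: "point \<Rightarrow> point \<Rightarrow> point \<Rightarrow> point" where
  "orthocenter A B C = (THE P. (P - A) \<bullet> (C - B) = 0 \<and> (P - B) \<bullet> (A - C) = 0 \<and>
      (P - C) \<bullet> (B - A) = 0)"

text \<open>The foot of the altitude from the first argument.\<close>

definition altitude_foot :: "point \<Rightarrow> point \<Rightarrow> point \<Rightarrow> point" where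
  "altitude_foot A B C = (THE P. P \<in> affine hull {B, C} \<and> (P - A) \<bullet> (C - B) = 0)"

definition nine_point_center :: "point \<Rightarrow> point \<Rightarrow> point \<Rightarrow> point" where
  "nine_point_center A B C = circumcenter (midpoint B C) (midpoint C A) (midpoint A B)"

definition bevan_point :: "point \<Rightarrow> point \<Rightarrow> point \<Rightarrow> point" where
  "bevan_point A B C = circumcenter (excenter A B C) (excenter B C A) (excenter C A B)"

definition de_longchamps_point :: "point \<Rightarrow> point \<Rightarrow> point \<Rightarrow> point" where
  "de_longchamps_point A B C = 2 *\<^sub>R circumcenter A B C - orthocenter A B C"

definition is_excentral_triangle ::
    "point \<Rightarrow> point \<Rightarrow> point \<Rightarrow> point \<Rightarrow> point \<Rightarrow> point \<Rightarrow> bool" where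
  "is_excentral_triangle A B C H1 H2 H3 \<longleftrightarrow>
     A = excenter H1 H2 H3 \<and> B = excenter H2 H3 H1 \<and> C = excenter H3 H1 H2"

subsection \<open>Isogonal conjugation\<close>

text \<open>The isogonal conjugate of a point of the circumcircle is a point at infinity, so conjugates
  are taken in the projective plane: a pair \<^term>\<open>(q, s) \<noteq> 0\<close> of type \<^typ>\<open>point \<times> real\<close>
  represents the point \<^term>\<open>q /\<^sub>R s\<close> if \<^term>\<open>s \<noteq> 0\<close>, and the point at infinity in
  direction \<^term>\<open>q\<close> if \<^term>\<open>s = 0\<close>.  In both cases the line joining it to an
  affine point \<^term>\<open>V\<close> has direction \<^term>\<open>q - s *\<^sub>R V\<close>.\<close>

definition direction_to :: "point \<Rightarrow> point \<times> real \<Rightarrow> point" where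
  "direction_to V Q = fst Q - snd Q *\<^sub>R V"

text \<open>Reflection in the line spanned by \<^term>\<open>u\<close>.\<close>

definition line_reflection :: "point \<Rightarrow> point \<Rightarrow> point" where
  "line_reflection u x = (2 * (x \<bullet> u) / (u \<bullet> u)) *\<^sub>R u - x"

text \<open>The lines joining \<^term>\<open>A\<close> to \<^term>\<open>P\<close> and to \<^term>\<open>Q\<close> are symmetric in the bisector
  of the angle at \<^term>\<open>A\<close>.  The condition is void when \<^term>\<open>P\<close> or \<^term>\<open>Q\<close> is the
  point \<^term>\<open>A\<close> itself.\<close>

definition isogonal_at :: "point \<Rightarrow> point \<Rightarrow> point \<Rightarrow> point \<Rightarrow> point \<times> real \<Rightarrow> bool" where
  "isogonal_at A B C P Q \<longleftrightarrow>
     collinear {0, line_reflection (sgn (B - A) + sgn (C - A)) (P - A), direction_to A Q}"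

text \<open>For \<^term>\<open>P\<close> different from the vertices there is exactly one such projective point
  (the opposite vertex if \<^term>\<open>P\<close> lies on a side line).  The conjugates of a vertex are all
  the points of the opposite side line; hence a vertex always belongs to the locus below, in
  agreement with the equation of the cubic in barycentric coordinates.\<close>

definition is_isogonal_conjugate ::
    "point \<Rightarrow> point \<Rightarrow> point \<Rightarrow> point \<Rightarrow> point \<times> real \<Rightarrow> bool" where
  "is_isogonal_conjugate A B C P Q \<longleftrightarrow>
     Q \<noteq> 0 \<and> isogonal_at A B C P Q \<and> isogonal_at B C A P Q \<and> isogonal_at C A B P Q"

subsection \<open>The Darboux cubic\<close>

definition darboux_locus :: "point \<Rightarrow> point \<Rightarrow> point \<Rightarrow> point set" where
  "darboux_locus A B C = {P. \<exists>Q. is_isogonal_conjugate A B C P Q \<and>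
     collinear {0, de_longchamps_point A B C - P, direction_to P Q}}"

definition is_cubic_curve :: "point set \<Rightarrow> bool" where
  "is_cubic_curve K \<longleftrightarrow> (\<exists>c :: nat \<Rightarrow> nat \<Rightarrow> real. (\<exists>i\<le>3. c i (3 - i) \<noteq> 0) \<and>
     K = {P. (\<Sum>i\<le>3. \<Sum>j\<le>3 - i. c i j * (P $ 1) ^ i * (P $ 2) ^ j) = 0})"

definition is_cubic_through_darboux_points ::
    "point \<Rightarrow> point \<Rightarrow> point \<Rightarrow> point set \<Rightarrow> bool" where
  "is_cubic_through_darboux_points A B C K \<longleftrightarrow> is_cubic_curve K \<and>
     {A, B, C, excenter A B C, excenter B C A, excenter C A B,
      incenter A B C, circumcenter A B C, bevan_point A B C} \<subseteq> K"

text \<open>The Darboux cubic is described in two ways, as the cubic through the nine points and as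
  the locus.  For a scalene triangle these determine the same curve.  For an isosceles triangle
  infinitely many cubics pass through the nine points, the locus being only one of them.
  Both descriptions are admitted, so a statement about all Darboux cubics covers either one.\<close>

definition is_darboux_cubic :: "point \<Rightarrow> point \<Rightarrow> point \<Rightarrow> point set \<Rightarrow> bool" where
  "is_darboux_cubic A B C K \<longleftrightarrow>
     K = darboux_locus A B C \<or> is_cubic_through_darboux_points A B C K"

end

theory Submission
  imports Defs
begin

text \<open>Since internal and external bisectors are perpendicular, the vertices of the triangle are the
  feet of the altitudes of its excentral triangle and its incenter is the orthocenter of the
  latter.  The midpoints of any two of the four in- and excenters lie on the circumcircle
  (centre \<open>U\<close>).  Hence this circle is the nine-point circle of the excentral triangle, and the
  circumcenter of the excentral triangle is \<open>2 U - I\<close>.  So the nine points of the claim are the nine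
  points defining the Darboux cubic.  For the locus description one computes in barycentric
  coordinates, where the isogonal conjugate of \<open>(x, y, z)\<close> is
  \<open>(a\<^sup>2 y z, b\<^sup>2 z x, c\<^sup>2 x y)\<close> and the de Longchamps point is \<open>4 U - A - B - C\<close>.\<close>

section \<open>Plane vectors\<close>

text \<open>The oriented area of the parallelogram spanned by two vectors; it turns collinearity
  into a polynomial equation.\<close>

definition det2 :: "point \<Rightarrow> point \<Rightarrow> real" where
  "det2 u v = u $ 1 * v $ 2 - u $ 2 * v $ 1"

lemma collinear_0_iff_det2: "collinear {0, u, v} \<longleftrightarrow> det2 u v = 0"
proof
  assume "collinear {0, u, v}"
  then show "det2 u v = 0"
    by (auto simp: collinear_lemma det2_def)
next
  assume d: "det2 u v = 0"
  have "v = (v $ 1 / u $ 1) *\<^sub>R u" if "u $ 1 \<noteq> 0"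
    using that d by (simp add: vec_eq_iff forall_2 det2_def field_simps)
  moreover have "v = (v $ 2 / u $ 2) *\<^sub>R u" if "u $ 2 \<noteq> 0"
    using that d by (simp add: vec_eq_iff forall_2 det2_def field_simps)
  moreover have "u = 0" if "u $ 1 = 0" "u $ 2 = 0"
    using that by (simp add: vec_eq_iff forall_2)
  ultimately show "collinear {0, u, v}"
    unfolding collinear_lemma by blast
qed

lemma collinear_iff_det2: "collinear {A, B, C} \<longleftrightarrow> det2 (B - A) (C - A) = 0"
proof -
  have "collinear {A, B, C} \<longleftrightarrow> collinear {0, B - A, C - A}"
    using collinear_3[of B A C] by (simp add: insert_commute)
  then show ?thesis
    by (simp add: collinear_0_iff_det2)
qed

text \<open>The two conditions form a linear system with nonzero determinant
  \<open>det2 (B - A) (C - A)\<close>. This supplies the uniqueness in the definite descriptions of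
  circumcenter and orthocenter.\<close>

lemma orthogonal_to_sides_eq_0:
  fixes w :: point
  assumes "\<not> collinear {A, B, C}" "w \<bullet> (B - A) = 0" "w \<bullet> (C - A) = 0"
  shows "w = 0"
proof -
  let ?u = "B - A" and ?v = "C - A"
  have d: "det2 ?u ?v \<noteq> 0"
    using assms(1) by (simp add: collinear_iff_det2)
  have 1: "w $ 1 * ?u $ 1 + w $ 2 * ?u $ 2 = 0" "w $ 1 * ?v $ 1 + w $ 2 * ?v $ 2 = 0"
    using assms(2,3) by (simp_all add: inner_vec_def sum_2)
  have "w $ 1 * det2 ?u ?v = 0" "w $ 2 * det2 ?u ?v = 0"
    using 1 unfolding det2_def by algebra+
  then show ?thesis
    using d by (simp add: vec_eq_iff forall_2)
qed

section \<open>Uniqueness of circumcenter, orthocenter and altitude feet\<close>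

lemma circumcenter_eqI:
  assumes "\<not> collinear {A, B, C}" "dist P A = dist P B" "dist P B = dist P C"
  shows "circumcenter A B C = P"
  unfolding circumcenter_def
proof (rule the_equality)
  fix Q assume Q: "dist Q A = dist Q B \<and> dist Q B = dist Q C"
  \<comment> \<open>Since \<open>X \<bullet> X\<close> cancels, for \<open>X\<close> equidistant
    from \<open>Y\<close> and \<open>Z\<close> the product \<open>X \<bullet> (Y - Z)\<close>
    depends on \<open>Y\<close> and \<open>Z\<close> alone, so it agrees for \<open>Q\<close> and
    \<open>P\<close>.\<close>
  have sq: "2 * (X \<bullet> (Y - Z)) = (dist X Z)\<^sup>2 - (dist X Y)\<^sup>2 + Y \<bullet> Y - Z \<bullet> Z" for X Y Z :: point
    by (simp add: dist_norm power2_norm_eq_inner algebra_simps inner_commute)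
  have "(Q - P) \<bullet> (B - A) = 0" "(Q - P) \<bullet> (C - A) = 0"
    using sq[of Q B A] sq[of P B A] sq[of Q C A] sq[of P C A] assms(2,3) Q
    by (simp_all add: inner_diff_left)
  then show "Q = P"
    using orthogonal_to_sides_eq_0[OF assms(1)] by force
qed (use assms in auto)

lemma orthocenter_eqI:
  assumes "\<not> collinear {A, B, C}" "(P - A) \<bullet> (C - B) = 0" "(P - B) \<bullet> (A - C) = 0"
    "(P - C) \<bullet> (B - A) = 0"
  shows "orthocenter A B C = P"
  unfolding orthocenter_def
proof (rule the_equality)
  fix Q assume Q: "(Q - A) \<bullet> (C - B) = 0 \<and> (Q - B) \<bullet> (A - C) = 0 \<and> (Q - C) \<bullet> (B - A) = 0"
  have "(Q - P) \<bullet> (B - A) = 0" "(Q - P) \<bullet> (C - A) = 0"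
    using Q assms(2-4) by (simp_all add: algebra_simps)
  then show "Q = P"
    using orthogonal_to_sides_eq_0[OF assms(1)] by force
qed (use assms in auto)

lemma altitude_foot_eqI:
  assumes "B \<noteq> C" "P \<in> affine hull {B, C}" "(P - A) \<bullet> (C - B) = 0"
  shows "altitude_foot A B C = P"
  unfolding altitude_foot_def
proof (rule the_equality)
  fix Q assume Q: "Q \<in> affine hull {B, C} \<and> (Q - A) \<bullet> (C - B) = 0"
  obtain s where s: "Q = B + s *\<^sub>R (C - B)"
    using Q by (auto simp: affine_hull_2_alt)
  obtain t where t: "P = B + t *\<^sub>R (C - B)"
    using assms(2) by (auto simp: affine_hull_2_alt)
  have "(Q - P) \<bullet> (C - B) = 0"
    using Q assms(3) by (simp add: inner_diff_left)
  then have "(s - t) * ((C - B) \<bullet> (C - B)) = 0"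
    by (simp add: s t scaleR_diff_left[symmetric])
  then show "Q = P"
    using assms(1) by (simp add: s t)
qed (use assms in auto)


section \<open>Barycentric coordinates\<close>

text \<open>Homogeneous barycentric coordinates, normalised by their total. For total 0 the
  operation \<open>/\<^sub>R\<close> yields the zero vector, which explains the recurring condition
  \<open>x + y + z \<noteq> 0\<close>.\<close>

definition bary :: "point \<Rightarrow> point \<Rightarrow> point \<Rightarrow> real \<Rightarrow> real \<Rightarrow> real \<Rightarrow> point" where
  "bary A B C x y z = (x *\<^sub>R A + y *\<^sub>R B + z *\<^sub>R C) /\<^sub>R (x + y + z)"

lemma bary_rotate: "bary B C A y z x = bary A B C x y z"
  by (simp add: bary_def algebra_simps)

text \<open>Passes to the affine frame with origin \<open>A\<close>, where \<open>x\<close> survives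
  only in the total.\<close>

lemma bary_minus_vertex:
  assumes "x + y + z \<noteq> 0"
  shows "bary A B C x y z - A = (y *\<^sub>R (B - A) + z *\<^sub>R (C - A)) /\<^sub>R (x + y + z)"
  using assms by (simp add: bary_def vec_eq_iff divide_simps) (simp add: algebra_simps)

lemma bary_scale:
  assumes "k \<noteq> 0"
  shows "bary A B C (k * x) (k * y) (k * z) = bary A B C x y z"
  using assms by (simp add: bary_def vec_eq_iff distrib_left[symmetric]) (simp add: algebra_simps divide_simps)

lemma bary_exists:
  assumes "\<not> collinear {A, B, C}"
  obtains x y z where "x + y + z = 1" "P = bary A B C x y z"
proof -
  let ?d = "det2 (B - A) (C - A)"
  \<comment> \<open>Cramer's rule for \<open>P - A\<close> in the basis \<open>B - A\<close>,
    \<open>C - A\<close>.\<close>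
  define y z where "y = det2 (P - A) (C - A) / ?d" and "z = det2 (B - A) (P - A) / ?d"
  have d: "?d \<noteq> 0"
    using assms by (simp add: collinear_iff_det2)
  have "?d *\<^sub>R (P - A) = det2 (P - A) (C - A) *\<^sub>R (B - A) + det2 (B - A) (P - A) *\<^sub>R (C - A)"
    by (simp add: vec_eq_iff forall_2 det2_def algebra_simps)
  moreover have "det2 (P - A) (C - A) = ?d * y" "det2 (B - A) (P - A) = ?d * z"
    using d by (simp_all add: y_def z_def)
  ultimately have "?d *\<^sub>R (P - A) = ?d *\<^sub>R (y *\<^sub>R (B - A) + z *\<^sub>R (C - A))"
    by (simp add: scaleR_add_right)
  then have "P - A = y *\<^sub>R (B - A) + z *\<^sub>R (C - A)"
    using d scaleR_left_imp_eq by blast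
  also have "\<dots> = bary A B C (1 - y - z) y z - A"
    using bary_minus_vertex[of "1 - y - z" y z] by simp
  finally show ?thesis
    using that[of "1 - y - z" y z] by simp
qed

text \<open>The numerator is the determinant of the three coordinate triples, so that determinant
  decides collinearity in homogeneous coordinates.\<close>

lemma det2_bary:
  assumes "x + y + z \<noteq> 0" "x' + y' + z' \<noteq> 0" "x'' + y'' + z'' \<noteq> 0"
  shows "det2 (bary A B C x' y' z' - bary A B C x y z) (bary A B C x'' y'' z'' - bary A B C x y z) =
    (x * (y' * z'' - z' * y'') + y * (z' * x'' - x' * z'') + z * (x' * y'' - y' * x'')) /
    ((x + y + z) * (x' + y' + z') * (x'' + y'' + z'')) * det2 (B - A) (C - A)"
proof -
  have e: "bary A B C x y z = A + (y / (x + y + z)) *\<^sub>R (B - A) + (z / (x + y + z)) *\<^sub>R (C - A)"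
    if "x + y + z \<noteq> 0" for x y z
    using bary_minus_vertex[OF that, of A B C] by (simp add: algebra_simps divide_inverse)
  define s s' s'' where "s = x + y + z" and "s' = x' + y' + z'" and "s'' = x'' + y'' + z''"
  \<comment> \<open>Eliminating the first coordinates in favour of the totals leaves an identity in
    the frame at \<open>A\<close>.\<close>
  have x: "x = s - y - z" "x' = s' - y' - z'" "x'' = s'' - y'' - z''"
    by (simp_all add: s_def s'_def s''_def)
  have nz: "s \<noteq> 0" "s' \<noteq> 0" "s'' \<noteq> 0"
    using assms by (simp_all add: s_def s'_def s''_def)
  have b: "det2 (p *\<^sub>R u + q *\<^sub>R v) (p' *\<^sub>R u + q' *\<^sub>R v) = (p * q' - q * p') * det2 u v" for p q p' q' u v
    by (simp add: det2_def algebra_simps)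
  have "det2 (bary A B C x' y' z' - bary A B C x y z) (bary A B C x'' y'' z'' - bary A B C x y z) =
      det2 ((y'/s' - y/s) *\<^sub>R (B - A) + (z'/s' - z/s) *\<^sub>R (C - A))
        ((y''/s'' - y/s) *\<^sub>R (B - A) + (z''/s'' - z/s) *\<^sub>R (C - A))"
    unfolding e[OF assms(1)] e[OF assms(2)] e[OF assms(3)] s_def[symmetric] s'_def[symmetric] s''_def[symmetric]
    by (simp add: algebra_simps)
  also have "\<dots> = (x * (y' * z'' - z' * y'') + y * (z' * x'' - x' * z'') + z * (x' * y'' - y' * x'')) /
    (s * s' * s'') * det2 (B - A) (C - A)"
    unfolding b x using nz by (simp add: divide_simps) (simp add: algebra_simps)
  finally show ?thesis
    by (simp add: s_def s'_def s''_def)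
qed

text \<open>Linear independence of the sides at \<open>A\<close>, in the form used to compare
  coefficients.\<close>

lemma bary_eq_vertex_iff:
  assumes "\<not> collinear {A, B, C}" "x + y + z \<noteq> 0"
  shows "bary A B C x y z = A \<longleftrightarrow> y = 0 \<and> z = 0"
proof
  assume "bary A B C x y z = A"
  then have 0: "y *\<^sub>R (B - A) + z *\<^sub>R (C - A) = 0"
    using bary_minus_vertex[OF assms(2), of A B C] assms(2) by simp
  \<comment> \<open>Pairing with one side isolates the coefficient of the other.\<close>
  have "det2 (y *\<^sub>R (B - A) + z *\<^sub>R (C - A)) (C - A) = y * det2 (B - A) (C - A)"
    "det2 (B - A) (y *\<^sub>R (B - A) + z *\<^sub>R (C - A)) = z * det2 (B - A) (C - A)"
    by (simp_all add: det2_def algebra_simps)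
  then show "y = 0 \<and> z = 0"
    using assms(1) unfolding 0 by (simp add: collinear_iff_det2 det2_def)
next
  assume "y = 0 \<and> z = 0"
  then show "bary A B C x y z = A"
    using assms(2) by (simp add: bary_def)
qed

lemma noncollinear_neq:
  assumes "\<not> collinear {A, B, C}"
  shows "A \<noteq> B" "B \<noteq> C" "C \<noteq> A"
  using assms by (auto simp: insert_absorb insert_commute)

lemma noncollinear_rotate:
  assumes "\<not> collinear {A, B, C}"
  shows "\<not> collinear {B, C, A}" "\<not> collinear {C, A, B}"
  using assms by (simp_all add: insert_commute)

text \<open>Equality would put \<open>A\<close> on the segment from \<open>B\<close> to
  \<open>C\<close>.\<close>

lemma strict_triangle:
  fixes A B C :: point
  assumes "\<not> collinear {A, B, C}"
  shows "dist B C < dist C A + dist A B"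
proof (rule ccontr)
  assume "\<not> ?thesis"
  then have "dist B C = dist B A + dist A C"
    using dist_triangle[of B C A] by (simp add: dist_commute)
  then have "between (B, C) A"
    by (simp add: between)
  then show False
    using assms between_imp_collinear by (metis insert_commute)
qed


section \<open>In- and excenters\<close>

lemma sgn_diff_dist: "sgn (B - A) = (B - A) /\<^sub>R dist A B" for A B :: point
  by (simp add: sgn_div_norm dist_norm norm_minus_commute)

text \<open>Along the unit vectors of the legs, the point minus \<open>A\<close> has components
  \<open>y * dist A B\<close> and \<open>z * dist C A\<close> up to the common divisor
  \<open>x + y + z\<close>. The bisectors are where these are equal or opposite.\<close>

lemma bary_mem_bisector:
  assumes "\<not> collinear {A, B, C}" "x + y + z \<noteq> 0"
  shows "bary A B C x y z \<in> internal_bisector A B C \<longleftrightarrow> y * dist A B = z * dist C A"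
    and "bary A B C x y z \<in> external_bisector A B C \<longleftrightarrow> y * dist A B = - (z * dist C A)"
proof -
  \<comment> \<open>\<open>e = 1\<close> gives the internal and \<open>e = -1\<close> the external
    bisector.\<close>
  have *: "(\<exists>t. bary A B C x y z = A + t *\<^sub>R (sgn (B - A) + e *\<^sub>R sgn (C - A))) \<longleftrightarrow>
    y * dist A B = e * (z * dist C A)" (is "?L \<longleftrightarrow> ?R") if e: "e * e = 1" for e
  proof
    note ds = noncollinear_neq[OF assms(1)]
    {
      assume ?L
      then obtain t where t: "bary A B C x y z = A + t *\<^sub>R (sgn (B - A) + e *\<^sub>R sgn (C - A))"
        by blast
      let ?y = "t / dist A B" and ?z = "e * t / dist C A"
      have "(y *\<^sub>R (B - A) + z *\<^sub>R (C - A)) /\<^sub>R (x + y + z) = ?y *\<^sub>R (B - A) + ?z *\<^sub>R (C - A)"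
        unfolding bary_minus_vertex[OF assms(2), of A B C, symmetric] t sgn_diff_dist
        by (simp add: scaleR_add_right divide_inverse dist_commute mult_ac)
      then have "(y / (x + y + z) - ?y) *\<^sub>R (B - A) + (z / (x + y + z) - ?z) *\<^sub>R (C - A) = 0"
        by (simp add: algebra_simps divide_inverse)
      \<comment> \<open>The difference of two expansions of one vector, read as coordinates of total
        1, denotes \<open>A\<close> itself; \<open>bary_eq_vertex_iff\<close> then compares
        coefficients.\<close>
      then have "bary A B C (1 - (y / (x + y + z) - ?y) - (z / (x + y + z) - ?z))
         (y / (x + y + z) - ?y) (z / (x + y + z) - ?z) = A"
        using bary_minus_vertex[of "1 - (y / (x + y + z) - ?y) - (z / (x + y + z) - ?z)"
         "(y / (x + y + z) - ?y)" "(z / (x + y + z) - ?z)" A B C] by simp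
      then have "y / (x + y + z) = ?y" "z / (x + y + z) = ?z"
        using bary_eq_vertex_iff[OF assms(1)] by auto
      then have "y * dist A B = t * (x + y + z)" "z * dist C A = e * t * (x + y + z)"
        using ds assms(2) by (simp_all add: frac_eq_eq)
      then show ?R
        using e by algebra
    }
    {
      assume r: ?R
      have "z * dist C A = e * (y * dist A B)"
        using r e by algebra
      then have "y = (y * dist A B) / dist A B" "z = e * (y * dist A B) / dist C A"
        using ds by (simp_all add: eq_divide_eq)
      then have "y *\<^sub>R (B - A) + z *\<^sub>R (C - A) =
          ((y * dist A B) / dist A B) *\<^sub>R (B - A) + (e * (y * dist A B) / dist C A) *\<^sub>R (C - A)"
        by metis
      also have "\<dots> = (y * dist A B) *\<^sub>R (sgn (B - A) + e *\<^sub>R sgn (C - A))"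
        unfolding sgn_diff_dist
        by (simp only: scaleR_add_right scaleR_scaleR divide_inverse mult_ac dist_commute[of C A])
      finally have *: "y *\<^sub>R (B - A) + z *\<^sub>R (C - A) =
          (y * dist A B) *\<^sub>R (sgn (B - A) + e *\<^sub>R sgn (C - A))" .
      have "bary A B C x y z = A + ((y * dist A B) / (x + y + z)) *\<^sub>R
          (sgn (B - A) + e *\<^sub>R sgn (C - A))"
        using bary_minus_vertex[OF assms(2), of A B C] unfolding *
        by (simp only: scaleR_scaleR divide_inverse mult.commute diff_eq_eq add.commute)
      then show ?L ..
    }
  qed
  show "bary A B C x y z \<in> internal_bisector A B C \<longleftrightarrow> y * dist A B = z * dist C A"
    using *[of 1] by (simp add: internal_bisector_def)
  show "bary A B C x y z \<in> external_bisector A B C \<longleftrightarrow> y * dist A B = - (z * dist C A)"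
    using *[of "-1"] by (simp add: external_bisector_def)
qed

lemma incenter_bary:
  assumes "\<not> collinear {A, B, C}"
  shows "incenter A B C = bary A B C (dist B C) (dist C A) (dist A B)"
    (is "_ = bary A B C ?a ?b ?c")
proof -
  note nc = assms noncollinear_rotate[OF assms]
  have pos: "?a > 0" "?b > 0" "?c > 0"
    using noncollinear_neq[OF assms] by simp_all
  \<comment> \<open>Read in one frame, the bisectors say that \<open>x\<close>, \<open>y\<close>,
    \<open>z\<close> are proportional to the side lengths.\<close>
  have m: "bary A B C x y z \<in> internal_bisector A B C \<and> bary A B C x y z \<in> internal_bisector B C A \<and>
      bary A B C x y z \<in> internal_bisector C A B \<longleftrightarrow>
      y * ?c = z * ?b \<and> z * ?a = x * ?c \<and> x * ?b = y * ?a"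
    if "x + y + z \<noteq> 0" for x y z
    using that bary_mem_bisector(1)[OF nc(1), of x y z] bary_mem_bisector(1)[OF nc(2), of y z x]
      bary_mem_bisector(1)[OF nc(3), of z x y]
    by (simp add: bary_rotate add_ac)
  show ?thesis
    unfolding incenter_def
  proof (rule the_equality)
    show "bary A B C ?a ?b ?c \<in> internal_bisector A B C \<and>
      bary A B C ?a ?b ?c \<in> internal_bisector B C A \<and> bary A B C ?a ?b ?c \<in> internal_bisector C A B"
      using m[of ?a ?b ?c] pos by simp
  next
    fix P
    assume P: "P \<in> internal_bisector A B C \<and> P \<in> internal_bisector B C A \<and> P \<in> internal_bisector C A B"
    obtain x y z where xyz: "x + y + z = 1" "P = bary A B C x y z"
      using bary_exists[OF assms] .
    then have "y * ?c = z * ?b" "z * ?a = x * ?c" "x * ?b = y * ?a"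
      using m[of x y z] P by auto
    then have "y = (x / ?a) * ?b" "z = (x / ?a) * ?c" "x = (x / ?a) * ?a"
      using pos by (simp_all add: field_simps)
    \<comment> \<open>A vanishing factor would make all coordinates 0, against their total
      1.\<close>
    moreover from this have "x / ?a \<noteq> 0"
      using xyz(1) by force
    ultimately show "P = bary A B C ?a ?b ?c"
      using bary_scale[of "x / ?a" A B C ?a ?b ?c] xyz(2) by simp
  qed
qed

text \<open>Same scheme as for the incenter; the two external bisectors flip the sign of the first
  coordinate.\<close>

lemma excenter_bary:
  assumes "\<not> collinear {A, B, C}"
  shows "excenter A B C = bary A B C (- dist B C) (dist C A) (dist A B)"
    (is "_ = bary A B C (- ?a) ?b ?c")
proof -
  note nc = assms noncollinear_rotate[OF assms]
  \<comment> \<open>The last entry, from the strict triangle inequality, is the nonzero total of the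
    excenter's coordinates.\<close>
  have pos: "?a > 0" "?b > 0" "?c > 0" "- ?a + ?b + ?c \<noteq> 0"
    using noncollinear_neq[OF assms] strict_triangle[OF assms] by simp_all
  have m: "bary A B C x y z \<in> internal_bisector A B C \<and> bary A B C x y z \<in> external_bisector B C A \<and>
      bary A B C x y z \<in> external_bisector C A B \<longleftrightarrow>
      y * ?c = z * ?b \<and> z * ?a = - (x * ?c) \<and> x * ?b = - (y * ?a)"
    if "x + y + z \<noteq> 0" for x y z
    using that bary_mem_bisector(1)[OF nc(1), of x y z] bary_mem_bisector(2)[OF nc(2), of y z x]
      bary_mem_bisector(2)[OF nc(3), of z x y]
    by (simp add: bary_rotate add_ac)
  show ?thesis
    unfolding excenter_def
  proof (rule the_equality)
    show "bary A B C (- ?a) ?b ?c \<in> internal_bisector A B C \<and>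
      bary A B C (- ?a) ?b ?c \<in> external_bisector B C A \<and>
      bary A B C (- ?a) ?b ?c \<in> external_bisector C A B"
      using m[of "- ?a" ?b ?c] pos by simp
  next
    fix P
    assume P: "P \<in> internal_bisector A B C \<and> P \<in> external_bisector B C A \<and> P \<in> external_bisector C A B"
    obtain x y z where xyz: "x + y + z = 1" "P = bary A B C x y z"
      using bary_exists[OF assms] .
    then have "y * ?c = z * ?b" "z * ?a = - (x * ?c)" "x * ?b = - (y * ?a)"
      using m[of x y z] P by auto
    then have "y = (- x / ?a) * ?b" "z = (- x / ?a) * ?c" "x = (- x / ?a) * (- ?a)"
      using pos by (simp_all add: field_simps)
    moreover from this have "- x / ?a \<noteq> 0"
      using xyz(1) by force
    ultimately show "P = bary A B C (- ?a) ?b ?c"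
      using bary_scale[of "- x / ?a" A B C "- ?a" ?b ?c] xyz(2) by simp
  qed
qed


section \<open>The circumcircle\<close>

text \<open>The subtracted fraction is the negative of the power of the point, so its numerator set
  to 0 is the equation of the circumcircle.\<close>

lemma dist_circumcenter_bary:
  assumes "x + y + z \<noteq> 0" "dist U A = R" "dist U B = R" "dist U C = R"
  shows "(dist U (bary A B C x y z))\<^sup>2 = R\<^sup>2 -
    ((dist B C)\<^sup>2 * y * z + (dist C A)\<^sup>2 * z * x + (dist A B)\<^sup>2 * x * y) / (x + y + z)\<^sup>2"
proof -
  define s where "s = x + y + z"
  \<comment> \<open>With \<open>U\<close> as origin the vertices have norm \<open>R\<close>, and the
    law of cosines expresses their inner products by the sides.\<close>
  define p q r where "p = A - U" and "q = B - U" and "r = C - U"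
  have s: "s \<noteq> 0" "x + y + z = s"
    using assms(1) by (simp_all add: s_def)
  have n: "p \<bullet> p = R\<^sup>2" "q \<bullet> q = R\<^sup>2" "r \<bullet> r = R\<^sup>2"
    using assms(2-4) by (simp_all add: p_def q_def r_def dist_norm norm_minus_commute power2_norm_eq_inner[symmetric])
  have d: "(dist B C)\<^sup>2 = 2 * R\<^sup>2 - 2 * (q \<bullet> r)" "(dist C A)\<^sup>2 = 2 * R\<^sup>2 - 2 * (p \<bullet> r)"
    "(dist A B)\<^sup>2 = 2 * R\<^sup>2 - 2 * (p \<bullet> q)"
  proof -
    have "dist B C = norm (q - r)" "dist C A = norm (r - p)" "dist A B = norm (p - q)"
      by (simp_all add: dist_norm p_def q_def r_def)
    then show "(dist B C)\<^sup>2 = 2 * R\<^sup>2 - 2 * (q \<bullet> r)" "(dist C A)\<^sup>2 = 2 * R\<^sup>2 - 2 * (p \<bullet> r)"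
      "(dist A B)\<^sup>2 = 2 * R\<^sup>2 - 2 * (p \<bullet> q)"
      using n by (simp_all add: power2_norm_eq_inner inner_diff_left inner_diff_right inner_commute)
  qed
  have "U + (bary A B C x y z - U) = U + (x *\<^sub>R p + y *\<^sub>R q + z *\<^sub>R r) /\<^sub>R s"
  proof -
    have "s *\<^sub>R (bary A B C x y z - U) = x *\<^sub>R p + y *\<^sub>R q + z *\<^sub>R r"
      unfolding bary_def s(2) p_def q_def r_def using s(1)
      by (simp add: scaleR_diff_right) (simp add: s_def algebra_simps)
    then have "(x *\<^sub>R p + y *\<^sub>R q + z *\<^sub>R r) /\<^sub>R s = bary A B C x y z - U"
      using s(1) by (metis left_inverse scaleR_one scaleR_scaleR)
    then show ?thesis
      by simp
  qed
  then have "(dist U (bary A B C x y z))\<^sup>2 = (norm ((x *\<^sub>R p + y *\<^sub>R q + z *\<^sub>R r) /\<^sub>R s))\<^sup>2"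
    by (simp add: dist_norm norm_minus_commute)
  also have "\<dots> = ((x *\<^sub>R p + y *\<^sub>R q + z *\<^sub>R r) \<bullet> (x *\<^sub>R p + y *\<^sub>R q + z *\<^sub>R r)) / s\<^sup>2"
    by (simp add: power2_norm_eq_inner[symmetric] power_mult_distrib divide_inverse power_inverse mult.commute)
  also have "(x *\<^sub>R p + y *\<^sub>R q + z *\<^sub>R r) \<bullet> (x *\<^sub>R p + y *\<^sub>R q + z *\<^sub>R r) =
      (x\<^sup>2 + y\<^sup>2 + z\<^sup>2) * R\<^sup>2 + 2 * x * y * (p \<bullet> q) + 2 * x * z * (p \<bullet> r) + 2 * y * z * (q \<bullet> r)"
    using n by (simp add: inner_add_left inner_add_right inner_commute power2_eq_square algebra_simps)
  also have "\<dots> = s\<^sup>2 * R\<^sup>2 - ((dist B C)\<^sup>2 * y * z + (dist C A)\<^sup>2 * z * x + (dist A B)\<^sup>2 * x * y)"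
    unfolding d s_def by (simp add: power2_eq_square algebra_simps)
  finally show ?thesis
    using s by (simp add: diff_divide_distrib)
qed

text \<open>The classical coordinates, proportional to the sines of the doubled angles. Their total
  \<open>N\<close> is Heron's expression for 16 times the squared area, hence positive.\<close>

lemma circumcenter_bary:
  assumes nc: "\<not> collinear {A, B, C}"
  defines "a \<equiv> dist B C" and "b \<equiv> dist C A" and "c \<equiv> dist A B"
  defines "U \<equiv> bary A B C (a\<^sup>2 * (b\<^sup>2 + c\<^sup>2 - a\<^sup>2)) (b\<^sup>2 * (c\<^sup>2 + a\<^sup>2 - b\<^sup>2)) (c\<^sup>2 * (a\<^sup>2 + b\<^sup>2 - c\<^sup>2))"
    and "N \<equiv> (a + b + c) * (b + c - a) * (c + a - b) * (a + b - c)"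
  shows "circumcenter A B C = U" "dist U A = dist U B" "dist U B = dist U C" "N > 0"
    "a\<^sup>2 * (b\<^sup>2 + c\<^sup>2 - a\<^sup>2) + b\<^sup>2 * (c\<^sup>2 + a\<^sup>2 - b\<^sup>2) + c\<^sup>2 * (a\<^sup>2 + b\<^sup>2 - c\<^sup>2) = N"
proof -
  have "a < b + c" "b < c + a" "c < a + b"
    using strict_triangle[OF nc] strict_triangle[OF noncollinear_rotate(1)[OF nc]]
      strict_triangle[OF noncollinear_rotate(2)[OF nc]]
    by (simp_all add: a_def b_def c_def)
  then show N: "N > 0"
    unfolding N_def using noncollinear_neq[OF nc]
    by (intro mult_pos_pos) (simp_all add: a_def b_def c_def add_pos_pos)
  define x y z where "x = a\<^sup>2 * (b\<^sup>2 + c\<^sup>2 - a\<^sup>2)" and "y = b\<^sup>2 * (c\<^sup>2 + a\<^sup>2 - b\<^sup>2)"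
    and "z = c\<^sup>2 * (a\<^sup>2 + b\<^sup>2 - c\<^sup>2)"
  show sum: "a\<^sup>2 * (b\<^sup>2 + c\<^sup>2 - a\<^sup>2) + b\<^sup>2 * (c\<^sup>2 + a\<^sup>2 - b\<^sup>2) + c\<^sup>2 * (a\<^sup>2 + b\<^sup>2 - c\<^sup>2) = N"
    unfolding N_def by (simp add: power2_eq_square algebra_simps)
  let ?u = "B - A" and ?v = "C - A"
  have uv: "?u \<bullet> ?u = c\<^sup>2" "?v \<bullet> ?v = b\<^sup>2" "2 * (?u \<bullet> ?v) = b\<^sup>2 + c\<^sup>2 - a\<^sup>2"
    unfolding a_def b_def c_def
    by (simp_all add: dist_norm power2_norm_eq_inner algebra_simps inner_commute)
  have UA: "U - A = (y *\<^sub>R ?u + z *\<^sub>R ?v) /\<^sub>R N"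
    using bary_minus_vertex[of x y z A B C] N sum by (simp add: U_def x_def y_def z_def)
  have NUA: "N * ((U - A) \<bullet> X) = y * (?u \<bullet> X) + z * (?v \<bullet> X)" for X
    using N unfolding UA by (simp add: inner_add_left divide_simps)
  \<comment> \<open>The aim is the equation of the perpendicular bisector of \<open>A\<close> and
    \<open>B\<close> in the frame at \<open>A\<close>; the second chain does the same for
    \<open>C\<close>.\<close>
  have "2 * (N * ((U - A) \<bullet> ?u)) = 2 * y * (?u \<bullet> ?u) + z * (2 * (?u \<bullet> ?v))"
    unfolding NUA by (simp add: inner_commute[of "C - A" "B - A"])
  also have "\<dots> = N * c\<^sup>2"
    unfolding uv unfolding N_def y_def z_def by (simp add: power2_eq_square algebra_simps)
  finally have 1: "2 * ((U - A) \<bullet> ?u) = ?u \<bullet> ?u"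
    using N uv(1) by simp
  have "2 * (N * ((U - A) \<bullet> ?v)) = y * (2 * (?u \<bullet> ?v)) + 2 * z * (?v \<bullet> ?v)"
    unfolding NUA by (simp add: inner_commute[of "C - A" "B - A"])
  also have "\<dots> = N * b\<^sup>2"
    unfolding uv unfolding N_def y_def z_def by (simp add: power2_eq_square algebra_simps)
  finally have 2: "2 * ((U - A) \<bullet> ?v) = ?v \<bullet> ?v"
    using N uv(2) by simp
  have *: "dist U X = dist U A" if "2 * ((U - A) \<bullet> (X - A)) = (X - A) \<bullet> (X - A)" for X
  proof -
    have "(dist U X)\<^sup>2 = (dist U A)\<^sup>2"
      using that by (simp add: dist_norm power2_norm_eq_inner algebra_simps inner_commute)
    then show ?thesis
      by simp
  qed
  show "dist U A = dist U B" "dist U B = dist U C"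
    using *[OF 1] *[OF 2] by simp_all
  then show "circumcenter A B C = U"
    by (rule circumcenter_eqI[OF nc])
qed

lemma dist_circumcenter:
  assumes "\<not> collinear {A, B, C}"
  obtains R where "dist (circumcenter A B C) A = R" "dist (circumcenter A B C) B = R"
    "dist (circumcenter A B C) C = R"
  using circumcenter_bary[OF assms] by metis

text \<open>The orthocenter minus one vertex is the sum of the radius vectors to the other two.
  These have equal length, so their sum is orthogonal to their difference.\<close>

lemma orthocenter_circumcenter:
  assumes "\<not> collinear {A, B, C}"
  shows "orthocenter A B C = A + B + C - 2 *\<^sub>R circumcenter A B C"
proof -
  obtain R where R: "dist (circumcenter A B C) A = R" "dist (circumcenter A B C) B = R"
    "dist (circumcenter A B C) C = R"
    using dist_circumcenter[OF assms] .
  define U where "U = circumcenter A B C"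
  have *: "(X + Y - 2 *\<^sub>R U) \<bullet> (Y - X) = 0" if "dist U X = R" "dist U Y = R" for X Y
  proof -
    have "(dist U X)\<^sup>2 = (dist U Y)\<^sup>2"
      using that by simp
    then show ?thesis
      by (simp add: dist_norm power2_norm_eq_inner algebra_simps inner_commute)
  qed
  show ?thesis
    using *[of B C] *[of C A] *[of A B] R unfolding U_def[symmetric]
    by (intro orthocenter_eqI[OF assms]) (simp_all add: algebra_simps)
qed


section \<open>The excentral triangle\<close>

text \<open>Such rotation rules carry results about the first vertex to the other two; the defining
  predicate is merely permuted.\<close>

lemma circumcenter_rotate: "circumcenter B C A = circumcenter A B C"
  unfolding circumcenter_def by (rule arg_cong[where f = The]) auto

lemma incenter_rotate: "incenter B C A = incenter A B C"
  unfolding incenter_def by (rule arg_cong[where f = The]) auto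

lemma excenters_bary:
  assumes "\<not> collinear {A, B, C}"
  shows "excenter A B C = bary A B C (- dist B C) (dist C A) (dist A B)"
    "excenter B C A = bary A B C (dist B C) (- dist C A) (dist A B)"
    "excenter C A B = bary A B C (dist B C) (dist C A) (- dist A B)"
  using excenter_bary[OF assms] excenter_bary[OF noncollinear_rotate(1)[OF assms]]
    excenter_bary[OF noncollinear_rotate(2)[OF assms]]
  by (simp_all only: bary_rotate[of B C A] bary_rotate[of C A B])

lemma side_lengths:
  fixes A B C :: point
  assumes "\<not> collinear {A, B, C}"
  shows "dist B C > 0" "dist C A > 0" "dist A B > 0"
    "- dist B C + dist C A + dist A B > 0" "dist B C - dist C A + dist A B > 0"
    "dist B C + dist C A - dist A B > 0"
  using noncollinear_neq[OF assms] strict_triangle[OF assms]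
    strict_triangle[OF noncollinear_rotate(1)[OF assms]]
    strict_triangle[OF noncollinear_rotate(2)[OF assms]]
  by simp_all

lemma excentral_noncollinear:
  assumes "\<not> collinear {A, B, C}"
  shows "\<not> collinear {excenter A B C, excenter B C A, excenter C A B}"
proof -
  define a b c where "a = dist B C" and "b = dist C A" and "c = dist A B"
  have sl: "a > 0" "b > 0" "c > 0" "- a + b + c \<noteq> 0" "a - b + c \<noteq> 0" "a + b - c \<noteq> 0"
    using side_lengths[OF assms] by (simp_all add: a_def b_def c_def)
  have "det2 (B - A) (C - A) \<noteq> 0"
    using assms by (simp add: collinear_iff_det2)
  \<comment> \<open>The determinant of the three excenter triples, to be inserted in
    \<open>det2_bary\<close>.\<close>
  moreover have "(- a) * ((- b) * (- c) - c * b) + b * (c * a - a * (- c)) + c * (a * b - (- b) * a) = 4 * a * b * c"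
    by (simp add: algebra_simps)
  ultimately show ?thesis
    using sl det2_bary[of "- a" b c a "- b" c a b "- c" A B C]
    by (simp add: collinear_iff_det2 excenters_bary[OF assms] a_def[symmetric] b_def[symmetric] c_def[symmetric])
qed

text \<open>\<open>X\<close> and the incenter lie on the internal bisector at \<open>A\<close>,
  \<open>Y\<close> and \<open>Z\<close> on the external one. The bisectors are orthogonal because
  the sum and the difference of two unit vectors are.\<close>

lemma excentral_altitude:
  assumes nc: "\<not> collinear {A, B, C}"
  defines "X \<equiv> excenter A B C" and "Y \<equiv> excenter B C A" and "Z \<equiv> excenter C A B"
  shows "altitude_foot X Y Z = A" "(incenter A B C - X) \<bullet> (Z - Y) = 0"
proof -
  note sl = side_lengths[OF nc]
  have "X \<in> internal_bisector A B C" "incenter A B C \<in> internal_bisector A B C"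
    "Y \<in> external_bisector A B C" "Z \<in> external_bisector A B C"
    using sl unfolding X_def Y_def Z_def excenters_bary[OF nc] incenter_bary[OF nc]
    by (simp_all add: bary_mem_bisector[OF nc])
  then obtain s s' t t' where X: "X = A + s *\<^sub>R (sgn (B - A) + sgn (C - A))"
    and I: "incenter A B C = A + s' *\<^sub>R (sgn (B - A) + sgn (C - A))"
    and Y: "Y = A + t *\<^sub>R (sgn (B - A) - sgn (C - A))"
    and Z: "Z = A + t' *\<^sub>R (sgn (B - A) - sgn (C - A))"
    unfolding internal_bisector_def external_bisector_def by blast
  have "sgn V \<bullet> sgn V = 1" if "V \<noteq> 0" for V :: point
    using that by (simp add: norm_sgn power2_norm_eq_inner[symmetric])
  then have perp: "(sgn (B - A) + sgn (C - A)) \<bullet> (sgn (B - A) - sgn (C - A)) = 0"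
    using noncollinear_neq[OF nc]
    by (simp add: inner_add_left inner_diff_right inner_commute[of "sgn (B - A)" "sgn (C - A)"])
  have ZY: "Z - Y = (t' - t) *\<^sub>R (sgn (B - A) - sgn (C - A))"
    by (simp add: Y Z algebra_simps)
  have IX: "incenter A B C - X = (s' - s) *\<^sub>R (sgn (B - A) + sgn (C - A))"
    by (simp add: I X algebra_simps)
  show "(incenter A B C - X) \<bullet> (Z - Y) = 0"
    unfolding IX ZY using perp by simp
  have AX: "A - X = (- s) *\<^sub>R (sgn (B - A) + sgn (C - A))"
    by (simp add: X)
  have "Y \<noteq> Z"
    using noncollinear_neq(2)[OF excentral_noncollinear[OF nc]] by (simp add: Y_def Z_def)
  then have "t' - t \<noteq> 0"
    by (auto simp: Y Z)
  \<comment> \<open>The parameter solves \<open>t + u * (t' - t) = 0\<close> for \<open>u\<close>,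
    as \<open>A\<close> has parameter 0 on the external bisector.\<close>
  then have "A = Y + (- t / (t' - t)) *\<^sub>R (Z - Y)"
    unfolding ZY by (simp add: Y)
  then have "A \<in> affine hull {Y, Z}"
    unfolding affine_hull_2_alt by (rule range_eqI)
  moreover have "(A - X) \<bullet> (Z - Y) = 0"
    unfolding AX ZY using perp by simp
  ultimately show "altitude_foot X Y Z = A"
    using \<open>Y \<noteq> Z\<close> by (intro altitude_foot_eqI)
qed

lemma excentral_orthocenter:
  assumes "\<not> collinear {A, B, C}"
  shows "orthocenter (excenter A B C) (excenter B C A) (excenter C A B) = incenter A B C"
  using excentral_altitude(2)[OF assms] excentral_altitude(2)[OF noncollinear_rotate(1)[OF assms]]
    excentral_altitude(2)[OF noncollinear_rotate(2)[OF assms]]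
  by (intro orthocenter_eqI[OF excentral_noncollinear[OF assms]])
    (simp_all add: incenter_rotate[of B C A] incenter_rotate[of C A B])

section \<open>Midpoints of in- and excenters on the circumcircle\<close>

lemma baryI:
  assumes "x + y + z \<noteq> 0" "(x + y + z) *\<^sub>R P = x *\<^sub>R A + y *\<^sub>R B + z *\<^sub>R C"
  shows "P = bary A B C x y z"
  unfolding bary_def assms(2)[symmetric] using assms(1) by simp

lemma scaleR_bary:
  assumes "x + y + z \<noteq> 0"
  shows "(x + y + z) *\<^sub>R bary A B C x y z = x *\<^sub>R A + y *\<^sub>R B + z *\<^sub>R C"
  unfolding bary_def using assms by simp

text \<open>Each triple is scaled by the total of the other, so that both get the total
  \<open>s * s'\<close> and can be added.\<close>

lemma midpoint_bary:
  assumes "x + y + z \<noteq> 0" "x' + y' + z' \<noteq> 0"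
  defines "s \<equiv> x + y + z" and "s' \<equiv> x' + y' + z'"
  shows "midpoint (bary A B C x y z) (bary A B C x' y' z') =
    bary A B C (s' * x + s * x') (s' * y + s * y') (s' * z + s * z')"
proof (rule baryI)
  have sum: "(s' * x + s * x') + (s' * y + s * y') + (s' * z + s * z') = 2 * s * s'"
    by (simp add: s_def s'_def algebra_simps)
  then show "(s' * x + s * x') + (s' * y + s * y') + (s' * z + s * z') \<noteq> 0"
    using assms(1,2) by (simp add: s_def s'_def)
  have "(2 * s * s') *\<^sub>R midpoint (bary A B C x y z) (bary A B C x' y' z') =
      s' *\<^sub>R (s *\<^sub>R bary A B C x y z) + s *\<^sub>R (s' *\<^sub>R bary A B C x' y' z')"
    by (simp add: midpoint_def algebra_simps)
  also have "\<dots> = (s' * x + s * x') *\<^sub>R A + (s' * y + s * y') *\<^sub>R B + (s' * z + s * z') *\<^sub>R C"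
    unfolding s_def s'_def scaleR_bary[OF assms(1)] scaleR_bary[OF assms(2)]
    by (simp add: scaleR_add_right scaleR_add_left)
  finally show "(s' * x + s * x' + (s' * y + s * y') + (s' * z + s * z')) *\<^sub>R
      midpoint (bary A B C x y z) (bary A B C x' y' z') =
      (s' * x + s * x') *\<^sub>R A + (s' * y + s * y') *\<^sub>R B + (s' * z + s * z') *\<^sub>R C"
    unfolding sum .
qed

text \<open>Only the squares of \<open>x\<close>, \<open>y\<close>, \<open>z\<close> are fixed. The
  free signs cover both pairs of excenters and pairs of the incenter with an excenter.\<close>

lemma tritangent_midpoint_on_circumcircle:
  assumes "x\<^sup>2 = (dist B C)\<^sup>2" "y\<^sup>2 = (dist C A)\<^sup>2" "z\<^sup>2 = (dist A B)\<^sup>2"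
    and s: "x - y + z \<noteq> 0" "x + y - z \<noteq> 0"
    and R: "dist U A = R" "dist U B = R" "dist U C = R"
  shows "dist U (midpoint (bary A B C x (- y) z) (bary A B C x y (- z))) = R"
proof -
  define p q r where "p = (x + y - z) * x + (x - y + z) * x"
    and "q = (x + y - z) * (- y) + (x - y + z) * y"
    and "r = (x + y - z) * z + (x - y + z) * (- z)"
  have m: "midpoint (bary A B C x (- y) z) (bary A B C x y (- z)) = bary A B C p q r"
    using midpoint_bary[of x "- y" z x y "- z" A B C] s by (simp add: p_def q_def r_def)
  have "p + q + r = 2 * (x - y + z) * (x + y - z)"
    by (simp add: p_def q_def r_def algebra_simps)
  then have "p + q + r \<noteq> 0"
    using s by simp
  \<comment> \<open>The circumcircle equation; here \<open>p = 2 * x\<^sup>2\<close>,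
    \<open>q = 2 * y * (z - y)\<close> and \<open>r = 2 * z * (y - z)\<close>.\<close>
  moreover have "x\<^sup>2 * q * r + y\<^sup>2 * r * p + z\<^sup>2 * p * q = 0"
    by (simp add: p_def q_def r_def power2_eq_square algebra_simps)
  ultimately have "(dist U (bary A B C p q r))\<^sup>2 = R\<^sup>2"
    using dist_circumcenter_bary[OF _ R, of p q r] assms(1-3) by simp
  then show ?thesis
    unfolding m using R(1) by (metis power2_eq_imp_eq zero_le_dist)
qed

lemma midpoint_excenters_on_circumcircle:
  assumes nc: "\<not> collinear {A, B, C}" and R: "dist U A = R" "dist U B = R" "dist U C = R"
  shows "dist U (midpoint (excenter B C A) (excenter C A B)) = R"
  unfolding excenters_bary[OF nc] using side_lengths[OF nc]
  by (intro tritangent_midpoint_on_circumcircle[OF _ _ _ _ _ R]) simp_all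

lemma midpoint_incenter_excenter_on_circumcircle:
  assumes nc: "\<not> collinear {A, B, C}" and R: "dist U A = R" "dist U B = R" "dist U C = R"
  shows "dist U (midpoint (incenter A B C) (excenter A B C)) = R"
proof -
  \<comment> \<open>Negating all coordinates matches the sign pattern of the midpoint lemma with
    \<open>y = - dist C A\<close>.\<close>
  have "bary A B C (- dist B C) (dist C A) (dist A B) = bary A B C (dist B C) (- dist C A) (- dist A B)"
    using bary_scale[of "- 1" A B C "- dist B C" "dist C A" "dist A B"] by simp
  then show ?thesis
    using tritangent_midpoint_on_circumcircle[of "dist B C" B C "- dist C A" A "dist A B", OF _ _ _ _ _ R]
      side_lengths[OF nc]
    unfolding excenters_bary[OF nc] incenter_bary[OF nc] by simp
qed

lemma excentral_nine_point_center:
  assumes nc: "\<not> collinear {A, B, C}"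
  shows "nine_point_center (excenter A B C) (excenter B C A) (excenter C A B) = circumcenter A B C"
proof -
  obtain R where R: "dist (circumcenter A B C) A = R" "dist (circumcenter A B C) B = R"
    "dist (circumcenter A B C) C = R"
    using dist_circumcenter[OF nc] .
  define X Y Z where "X = excenter A B C" and "Y = excenter B C A" and "Z = excenter C A B"
  \<comment> \<open>The medial triangle has a quarter of the area, so it is nondegenerate
    too.\<close>
  have "det2 (midpoint Z X - midpoint Y Z) (midpoint X Y - midpoint Y Z) = det2 (Y - X) (Z - X) / 4"
    by (simp add: midpoint_def det2_def field_simps)
  then have "\<not> collinear {midpoint Y Z, midpoint Z X, midpoint X Y}"
    using excentral_noncollinear[OF nc] by (simp add: collinear_iff_det2 X_def Y_def Z_def)
  moreover have "dist (circumcenter A B C) (midpoint Y Z) = R"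
    "dist (circumcenter A B C) (midpoint Z X) = R" "dist (circumcenter A B C) (midpoint X Y) = R"
    using midpoint_excenters_on_circumcircle[OF nc R]
      midpoint_excenters_on_circumcircle[OF noncollinear_rotate(1)[OF nc] R(2,3,1)]
      midpoint_excenters_on_circumcircle[OF noncollinear_rotate(2)[OF nc] R(3,1,2)]
    by (simp_all add: X_def Y_def Z_def)
  ultimately show ?thesis
    unfolding nine_point_center_def X_def[symmetric] Y_def[symmetric] Z_def[symmetric]
    by (intro circumcenter_eqI) simp_all
qed

text \<open>The homothety with centre the incenter and ratio 2 maps the midpoints, which lie on the
  circumcircle, to the excenters, and the circumcenter to the claimed point.\<close>

lemma bevan_point_eq:
  assumes nc: "\<not> collinear {A, B, C}"
  shows "bevan_point A B C = 2 *\<^sub>R circumcenter A B C - incenter A B C"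
proof -
  obtain R where R: "dist (circumcenter A B C) A = R" "dist (circumcenter A B C) B = R"
    "dist (circumcenter A B C) C = R"
    using dist_circumcenter[OF nc] .
  have *: "dist (2 *\<^sub>R U - J) X = 2 * dist U (midpoint J X)" for U J X :: point
  proof -
    have "2 *\<^sub>R U - J - X = 2 *\<^sub>R (U - midpoint J X)"
      by (simp add: midpoint_def algebra_simps)
    then show ?thesis
      by (simp add: dist_norm)
  qed
  show ?thesis
    unfolding bevan_point_def
    using midpoint_incenter_excenter_on_circumcircle[OF nc R]
      midpoint_incenter_excenter_on_circumcircle[OF noncollinear_rotate(1)[OF nc] R(2,3,1)]
      midpoint_incenter_excenter_on_circumcircle[OF noncollinear_rotate(2)[OF nc] R(3,1,2)]
    by (intro circumcenter_eqI[OF excentral_noncollinear[OF nc]])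
      (simp_all add: * incenter_rotate[of B C A] incenter_rotate[of C A B])
qed


section \<open>The Darboux locus\<close>

text \<open>In the basis of unit vectors \<open>e\<close>, \<open>f\<close> along the legs,
  reflection in the bisector swaps the two coefficients. The squared side lengths in
  \<open>eq\<close> come from changing to this basis on both lines.\<close>

lemma isogonal_atI:
  assumes nc: "\<not> collinear {A, B, C}"
    and P: "P - A = y *\<^sub>R (B - A) + z *\<^sub>R (C - A)"
    and Q: "direction_to A Q = q *\<^sub>R (B - A) + r *\<^sub>R (C - A)"
    and eq: "(dist C A)\<^sup>2 * z * r = (dist A B)\<^sup>2 * y * q"
  shows "isogonal_at A B C P Q"
proof -
  define b c where "b = dist C A" and "c = dist A B"
  define e f where "e = sgn (B - A)" and "f = sgn (C - A)"
  have pos: "b > 0" "c > 0"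
    using noncollinear_neq[OF nc] by (simp_all add: b_def c_def)
  have B: "B - A = c *\<^sub>R e" and C: "C - A = b *\<^sub>R f"
    using pos by (simp_all add: e_def f_def sgn_diff_dist b_def c_def dist_commute)
  have unit: "e \<bullet> e = 1" "f \<bullet> f = 1"
    using noncollinear_neq[OF nc] unfolding e_def f_def
    by (simp_all add: power2_norm_eq_inner[symmetric] norm_sgn)
  \<comment> \<open>Opposite unit vectors would make the triangle degenerate; a nonzero axis keeps
    the quotient in \<open>line_reflection\<close> meaningful.\<close>
  have "e + f \<noteq> 0"
  proof
    assume "e + f = 0"
    then have "f = - e"
      by (simp add: add_eq_0_iff)
    then have "det2 (B - A) (C - A) = 0"
      unfolding B C by (simp add: det2_def)
    then show False
      using nc by (simp add: collinear_iff_det2)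
  qed
  moreover have "(e + f) \<bullet> (e + f) = 2 * (1 + e \<bullet> f)"
    using unit by (simp add: inner_add_left inner_add_right inner_commute[of f e])
  ultimately have nz: "1 + e \<bullet> f \<noteq> 0"
    by (metis inner_eq_zero_iff mult_zero_right)
  have swap: "line_reflection (e + f) (\<alpha> *\<^sub>R e + \<beta> *\<^sub>R f) = \<beta> *\<^sub>R e + \<alpha> *\<^sub>R f" for \<alpha> \<beta>
  proof -
    have "(\<alpha> *\<^sub>R e + \<beta> *\<^sub>R f) \<bullet> (e + f) = (\<alpha> + \<beta>) * (1 + e \<bullet> f)"
      using unit by (simp add: inner_add_left inner_add_right inner_commute[of f e] algebra_simps)
    then have "2 * ((\<alpha> *\<^sub>R e + \<beta> *\<^sub>R f) \<bullet> (e + f)) / ((e + f) \<bullet> (e + f)) = \<alpha> + \<beta>"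
      using nz unfolding \<open>(e + f) \<bullet> (e + f) = 2 * (1 + e \<bullet> f)\<close> by (simp del: distrib_left_numeral)
    then show ?thesis
      unfolding line_reflection_def by (simp add: algebra_simps)
  qed
  have "P - A = (y * c) *\<^sub>R e + (z * b) *\<^sub>R f" "direction_to A Q = (q * c) *\<^sub>R e + (r * b) *\<^sub>R f"
    unfolding P Q B C by simp_all
  moreover have "det2 ((z * b) *\<^sub>R e + (y * c) *\<^sub>R f) ((q * c) *\<^sub>R e + (r * b) *\<^sub>R f) =
      (b\<^sup>2 * z * r - c\<^sup>2 * y * q) * det2 e f"
    by (simp add: det2_def power2_eq_square algebra_simps)
  ultimately show ?thesis
    using eq unfolding isogonal_at_def e_def[symmetric] f_def[symmetric]
    by (simp add: swap collinear_0_iff_det2 b_def c_def)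
qed

text \<open>The pair encodes homogeneous coordinates \<open>(p, q, r)\<close> without dividing by
  their total, so total 0 correctly gives a point at infinity.\<close>

lemma isogonal_at_baryI:
  assumes nc: "\<not> collinear {A, B, C}" and s: "x + y + z \<noteq> 0"
    and eq: "(dist C A)\<^sup>2 * z * r = (dist A B)\<^sup>2 * y * q"
  shows "isogonal_at A B C (bary A B C x y z) (p *\<^sub>R A + q *\<^sub>R B + r *\<^sub>R C, p + q + r)"
proof (rule isogonal_atI[OF nc])
  show "bary A B C x y z - A = (y / (x + y + z)) *\<^sub>R (B - A) + (z / (x + y + z)) *\<^sub>R (C - A)"
    unfolding bary_minus_vertex[OF s] by (simp add: scaleR_add_right divide_inverse mult.commute)
  show "direction_to A (p *\<^sub>R A + q *\<^sub>R B + r *\<^sub>R C, p + q + r) = q *\<^sub>R (B - A) + r *\<^sub>R (C - A)"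
    by (simp add: direction_to_def algebra_simps)
  show "(dist C A)\<^sup>2 * (z / (x + y + z)) * r = (dist A B)\<^sup>2 * (y / (x + y + z)) * q"
    using eq by (simp add: times_divide_eq_right times_divide_eq_left)
qed

text \<open>Here \<^term>\<open>(p, q, r)\<close> are barycentric coordinates of the isogonal conjugate, and the last
  assumption says that it is collinear with the point and the de Longchamps point.\<close>

lemma mem_darboux_locusI:
  assumes nc: "\<not> collinear {A, B, C}" and s: "x + y + z \<noteq> 0" and S: "l + m + n \<noteq> 0"
    and L: "de_longchamps_point A B C = bary A B C l m n"
    and nz: "p \<noteq> 0 \<or> q \<noteq> 0 \<or> r \<noteq> 0"
    and iso: "(dist C A)\<^sup>2 * z * r = (dist A B)\<^sup>2 * y * q"
      "(dist A B)\<^sup>2 * x * p = (dist B C)\<^sup>2 * z * r"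
      "(dist B C)\<^sup>2 * y * q = (dist C A)\<^sup>2 * x * p"
    and det: "l * (y * r - z * q) + m * (z * p - x * r) + n * (x * q - y * p) = 0"
  shows "bary A B C x y z \<in> darboux_locus A B C"
proof -
  define Q where "Q = (p *\<^sub>R A + q *\<^sub>R B + r *\<^sub>R C, p + q + r)"
  have d: "det2 (B - A) (C - A) \<noteq> 0"
    using nc by (simp add: collinear_iff_det2)
  have "Q \<noteq> 0"
  proof
    assume "Q = 0"
    then have 0: "p *\<^sub>R A + q *\<^sub>R B + r *\<^sub>R C = 0" "p = - q - r"
      by (simp_all add: Q_def zero_prod_def)
    \<comment> \<open>Adding the vanishing combination to \<open>A\<close> leaves \<open>A\<close>
      unchanged, which forces its coefficients to be 0.\<close>
    then have "bary A B C (1 - q - r) q r - A = 0"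
      using bary_minus_vertex[of "1 - q - r" q r A B C] by (simp add: algebra_simps)
    then have "q = 0 \<and> r = 0"
      using bary_eq_vertex_iff[OF nc, of "1 - q - r" q r] by simp
    then show False
      using nz 0(2) by simp
  qed
  moreover have "isogonal_at A B C (bary A B C x y z) Q"
    unfolding Q_def using isogonal_at_baryI[OF nc s iso(1)] .
  moreover have "isogonal_at B C A (bary A B C x y z) Q"
    using isogonal_at_baryI[OF noncollinear_rotate(1)[OF nc] _ iso(2), of y q] s
    unfolding Q_def by (simp add: bary_rotate[of B C A] add_ac)
  moreover have "isogonal_at C A B (bary A B C x y z) Q"
    using isogonal_at_baryI[OF noncollinear_rotate(2)[OF nc] _ iso(3), of z r] s
    unfolding Q_def by (simp add: bary_rotate[of B C A] bary_rotate[of C A B] add_ac)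
  moreover have "collinear {0, de_longchamps_point A B C - bary A B C x y z, direction_to (bary A B C x y z) Q}"
  proof -
    let ?s = "x + y + z" and ?S = "l + m + n" and ?t = "p + q + r"
    have e: "bary A B C x y z = A + (y / (x + y + z)) *\<^sub>R (B - A) + (z / (x + y + z)) *\<^sub>R (C - A)"
      if "x + y + z \<noteq> 0" for x y z
      using bary_minus_vertex[OF that, of A B C] by (simp add: algebra_simps divide_inverse)
    have 1: "de_longchamps_point A B C - bary A B C x y z =
        (m / ?S - y / ?s) *\<^sub>R (B - A) + (n / ?S - z / ?s) *\<^sub>R (C - A)"
      unfolding L e[OF s] e[OF S] by (simp add: algebra_simps)
    have 2: "direction_to (bary A B C x y z) Q =
        (q - ?t * (y / ?s)) *\<^sub>R (B - A) + (r - ?t * (z / ?s)) *\<^sub>R (C - A)"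
      unfolding e[OF s] Q_def direction_to_def by (simp add: algebra_simps)
    have 3: "det2 (f *\<^sub>R u + g *\<^sub>R v) (f' *\<^sub>R u + g' *\<^sub>R v) = (f * g' - g * f') * det2 u v" for f g f' g' u v
      by (simp add: det2_def algebra_simps)
    \<comment> \<open>Denominators are cleared so that the collinearity condition becomes the
      determinant of \<open>det\<close>, up to the factor \<open>- ?s\<close>.\<close>
    have "?S * ?s * ?s * ((m / ?S - y / ?s) * (r - ?t * (z / ?s)) - (n / ?S - z / ?s) * (q - ?t * (y / ?s))) =
        (m * ?s - y * ?S) * (r * ?s - ?t * z) - (n * ?s - z * ?S) * (q * ?s - ?t * y)"
    proof -
      have "?S * ?s * ((m / ?S - y / ?s)) = m * ?s - y * ?S" "?S * ?s * ((n / ?S - z / ?s)) = n * ?s - z * ?S"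
        "?s * (r - ?t * (z / ?s)) = r * ?s - ?t * z" "?s * (q - ?t * (y / ?s)) = q * ?s - ?t * y"
        using s S by (simp_all add: right_diff_distrib)
      then show ?thesis
        by algebra
    qed
    also have "\<dots> = - ?s * (l * (y * r - z * q) + m * (z * p - x * r) + n * (x * q - y * p))"
      by algebra
    finally have "(m / ?S - y / ?s) * (r - ?t * (z / ?s)) - (n / ?S - z / ?s) * (q - ?t * (y / ?s)) = 0"
      using s S det by simp
    then show ?thesis
      unfolding collinear_0_iff_det2 1 2 3 by simp
  qed
  ultimately show ?thesis
    unfolding darboux_locus_def is_isogonal_conjugate_def by blast
qed

section \<open>Cyclic symmetry and the vertices on the locus\<close>

lemma isogonal_conjugate_rotate: "is_isogonal_conjugate B C A = is_isogonal_conjugate A B C"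
  unfolding is_isogonal_conjugate_def fun_eq_iff by blast

lemma orthocenter_rotate: "orthocenter B C A = orthocenter A B C"
  unfolding orthocenter_def by (rule arg_cong[where f = The]) auto

lemma darboux_locus_rotate: "darboux_locus B C A = darboux_locus A B C"
  unfolding darboux_locus_def de_longchamps_point_def isogonal_conjugate_rotate[of B C A]
    circumcenter_rotate[of B C A] orthocenter_rotate[of B C A] ..

text \<open>Any point of the side opposite \<open>A\<close> serves as a conjugate of
  \<open>A\<close>; the proof takes the one on the line from \<open>A\<close> to the de Longchamps
  point.\<close>

lemma vertex_mem_darboux_locus:
  assumes nc: "\<not> collinear {A, B, C}"
  shows "A \<in> darboux_locus A B C"
proof -
  obtain l m n where lmn: "l + m + n = 1" "de_longchamps_point A B C = bary A B C l m n"
    using bary_exists[OF nc] .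
  have "bary A B C 1 0 0 \<in> darboux_locus A B C"
  \<comment> \<open>If \<open>m\<close> and \<open>n\<close> vanish, the de Longchamps point is
    \<open>A\<close> and the choice is arbitrary: \<open>B\<close> is taken. Otherwise the line from
    \<open>A\<close> meets the opposite side at \<open>(0, m, n)\<close>.\<close>
  proof (cases "m = 0 \<and> n = 0")
    case True
    then show ?thesis
      using lmn by (intro mem_darboux_locusI[OF nc, where p = 0 and q = 1 and r = 0]) auto
  next
    case False
    then show ?thesis
      using lmn by (intro mem_darboux_locusI[OF nc, where p = 0 and q = m and r = n]) auto
  qed
  then show ?thesis
    by (simp add: bary_def)
qed

section \<open>Coordinates of the de Longchamps and Bevan points\<close>

text \<open>By \<open>orthocenter_circumcenter\<close> the point is
  \<open>4 *\<^sub>R circumcenter A B C - (A + B + C)\<close>; multiplying by \<open>N\<close>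
  clears the denominator.\<close>

lemma de_longchamps_point_bary:
  assumes nc: "\<not> collinear {A, B, C}"
  defines "a \<equiv> dist B C" and "b \<equiv> dist C A" and "c \<equiv> dist A B"
  defines "N \<equiv> (a + b + c) * (b + c - a) * (c + a - b) * (a + b - c)"
  defines "l \<equiv> 4 * a\<^sup>2 * (b\<^sup>2 + c\<^sup>2 - a\<^sup>2) - N" and "m \<equiv> 4 * b\<^sup>2 * (c\<^sup>2 + a\<^sup>2 - b\<^sup>2) - N"
    and "n \<equiv> 4 * c\<^sup>2 * (a\<^sup>2 + b\<^sup>2 - c\<^sup>2) - N"
  shows "de_longchamps_point A B C = bary A B C l m n" "l + m + n = N"
proof -
  let ?x = "a\<^sup>2 * (b\<^sup>2 + c\<^sup>2 - a\<^sup>2)" and ?y = "b\<^sup>2 * (c\<^sup>2 + a\<^sup>2 - b\<^sup>2)" and ?z = "c\<^sup>2 * (a\<^sup>2 + b\<^sup>2 - c\<^sup>2)"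
  note cb = circumcenter_bary[OF nc, folded a_def b_def c_def, folded N_def]
  show sum: "l + m + n = N"
    using cb(5) by (simp add: l_def m_def n_def)
  have U: "N *\<^sub>R circumcenter A B C = ?x *\<^sub>R A + ?y *\<^sub>R B + ?z *\<^sub>R C"
    using scaleR_bary[of ?x ?y ?z A B C] cb(1,4,5) by simp
  have "N *\<^sub>R de_longchamps_point A B C = 4 *\<^sub>R (N *\<^sub>R circumcenter A B C) - N *\<^sub>R (A + B + C)"
    unfolding de_longchamps_point_def orthocenter_circumcenter[OF nc] by (simp add: algebra_simps)
  also have "\<dots> = l *\<^sub>R A + m *\<^sub>R B + n *\<^sub>R C"
    unfolding U l_def m_def n_def by (simp add: algebra_simps)
  finally show "de_longchamps_point A B C = bary A B C l m n"
    using cb(4) by (intro baryI) (simp_all add: sum)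
qed

text \<open>From \<open>bevan_point_eq\<close>, with the common denominator
  \<open>(a + b + c) * M\<close> of circumcenter and incenter.\<close>

lemma bevan_point_bary:
  assumes nc: "\<not> collinear {A, B, C}"
  defines "a \<equiv> dist B C" and "b \<equiv> dist C A" and "c \<equiv> dist A B"
  defines "M \<equiv> (b + c - a) * (c + a - b) * (a + b - c)"
  defines "x \<equiv> a * (2 * a * (b\<^sup>2 + c\<^sup>2 - a\<^sup>2) - M)" and "y \<equiv> b * (2 * b * (c\<^sup>2 + a\<^sup>2 - b\<^sup>2) - M)"
    and "z \<equiv> c * (2 * c * (a\<^sup>2 + b\<^sup>2 - c\<^sup>2) - M)"
  shows "bevan_point A B C = bary A B C x y z" "x + y + z = (a + b + c) * M" "(a + b + c) * M > 0"
proof -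
  define N where "N = (a + b + c) * (b + c - a) * (c + a - b) * (a + b - c)"
  let ?x = "a\<^sup>2 * (b\<^sup>2 + c\<^sup>2 - a\<^sup>2)" and ?y = "b\<^sup>2 * (c\<^sup>2 + a\<^sup>2 - b\<^sup>2)" and ?z = "c\<^sup>2 * (a\<^sup>2 + b\<^sup>2 - c\<^sup>2)"
  note cb = circumcenter_bary[OF nc, folded a_def b_def c_def, folded N_def]
  have N: "N = (a + b + c) * M"
    by (simp add: N_def M_def mult.assoc)
  show "(a + b + c) * M > 0"
    using cb(4) by (simp add: N)
  have "x + y + z = 2 * (?x + ?y + ?z) - (a + b + c) * M"
    by (simp add: x_def y_def z_def power2_eq_square algebra_simps)
  then show sum: "x + y + z = (a + b + c) * M"
    using cb(5) by (simp add: N)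
  have U: "N *\<^sub>R circumcenter A B C = ?x *\<^sub>R A + ?y *\<^sub>R B + ?z *\<^sub>R C"
    using scaleR_bary[of ?x ?y ?z A B C] cb(1,4,5) by simp
  have I: "(a + b + c) *\<^sub>R incenter A B C = a *\<^sub>R A + b *\<^sub>R B + c *\<^sub>R C"
    using scaleR_bary[of a b c A B C] side_lengths[OF nc] incenter_bary[OF nc]
    by (simp add: a_def b_def c_def)
  have "N *\<^sub>R bevan_point A B C = 2 *\<^sub>R (N *\<^sub>R circumcenter A B C) - M *\<^sub>R ((a + b + c) *\<^sub>R incenter A B C)"
    unfolding bevan_point_eq[OF nc] N by (simp add: scaleR_diff_right mult_ac)
  also have "\<dots> = x *\<^sub>R A + y *\<^sub>R B + z *\<^sub>R C"
    unfolding U I x_def y_def z_def by (simp add: power2_eq_square algebra_simps)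
  finally show "bevan_point A B C = bary A B C x y z"
    using cb(4) by (intro baryI) (simp_all add: sum N[symmetric])
qed

text \<open>The cubic equation of the Darboux cubic, in the coordinates with respect to which all
  tritangent centres are \<open>(\<plusminus>1, \<plusminus>1, \<plusminus>1)\<close> and isogonal conjugation is inversion.\<close>

lemma mem_darboux_locus_cubic:
  assumes nc: "\<not> collinear {A, B, C}"
  defines "a \<equiv> dist B C" and "b \<equiv> dist C A" and "c \<equiv> dist A B"
  defines "N \<equiv> (a + b + c) * (b + c - a) * (c + a - b) * (a + b - c)"
  assumes s: "a * x + b * y + c * z \<noteq> 0"
    and P: "P = bary A B C (a * x) (b * y) (c * z)" "P \<notin> {A, B, C}"
    and cubic: "(4 * a\<^sup>2 * (b\<^sup>2 + c\<^sup>2 - a\<^sup>2) - N) * b * c * x * (y\<^sup>2 - z\<^sup>2) +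
      (4 * b\<^sup>2 * (c\<^sup>2 + a\<^sup>2 - b\<^sup>2) - N) * c * a * y * (z\<^sup>2 - x\<^sup>2) +
      (4 * c\<^sup>2 * (a\<^sup>2 + b\<^sup>2 - c\<^sup>2) - N) * a * b * z * (x\<^sup>2 - y\<^sup>2) = 0"
      (is "?l * b * c * x * _ + ?m * c * a * y * _ + ?n * a * b * z * _ = 0")
  shows "P \<in> darboux_locus A B C"
proof -
  have pos: "a > 0" "b > 0" "c > 0"
    using side_lengths[OF nc] by (simp_all add: a_def b_def c_def)
  note L = de_longchamps_point_bary[OF nc, folded a_def b_def c_def, folded N_def]
  have N: "N \<noteq> 0"
    using circumcenter_bary(4)[OF nc, folded a_def b_def c_def, folded N_def] by simp
  \<comment> \<open>Two vanishing coordinates would give a vertex. Hence at most one is 0, and the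
    conjugate triple built from their pairwise products is not zero.\<close>
  have ne: "y \<noteq> 0 \<or> z \<noteq> 0" "z \<noteq> 0 \<or> x \<noteq> 0" "x \<noteq> 0 \<or> y \<noteq> 0"
  proof -
    have "bary A B C t 0 0 = A" "bary A B C 0 t 0 = B" "bary A B C 0 0 t = C" if "t \<noteq> 0" for t
      using that by (simp_all add: bary_def)
    then show "y \<noteq> 0 \<or> z \<noteq> 0" "z \<noteq> 0 \<or> x \<noteq> 0" "x \<noteq> 0 \<or> y \<noteq> 0"
      using P s by auto
  qed
  have "?l * (b * y * (c * x * y) - c * z * (b * z * x)) + ?m * (c * z * (a * y * z) - a * x * (c * x * y)) +
      ?n * (a * x * (b * z * x) - b * y * (a * y * z)) =
      ?l * b * c * x * (y\<^sup>2 - z\<^sup>2) + ?m * c * a * y * (z\<^sup>2 - x\<^sup>2) + ?n * a * b * z * (x\<^sup>2 - y\<^sup>2)"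
    by algebra
  then show ?thesis
    unfolding P(1) using N L pos ne cubic s
    by (intro mem_darboux_locusI[OF nc _ _ L(1), where p = "a * y * z" and q = "b * z * x" and r = "c * x * y"])
      (auto simp: a_def[symmetric] b_def[symmetric] c_def[symmetric] power2_eq_square)
qed

section \<open>The centres on the locus\<close>

text \<open>These points are their own isogonal conjugates: coordinates of absolute value 1 make
  every difference of squares in the cubic vanish.\<close>

lemma tritangent_centers_mem_darboux_locus:
  assumes nc: "\<not> collinear {A, B, C}"
  shows "incenter A B C \<in> darboux_locus A B C" "excenter A B C \<in> darboux_locus A B C"
proof -
  define a b c where "a = dist B C" and "b = dist C A" and "c = dist A B"
  have sl: "a > 0" "b > 0" "c > 0" "- a + b + c > 0"
    using side_lengths[OF nc] by (simp_all add: a_def b_def c_def)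
  have ne: "bary A B C x y z \<notin> {A, B, C}" if "x \<noteq> 0" "y \<noteq> 0" "z \<noteq> 0" "x + y + z \<noteq> 0" for x y z
    using that bary_eq_vertex_iff[OF nc, of x y z] bary_eq_vertex_iff[OF noncollinear_rotate(1)[OF nc], of y z x]
      bary_eq_vertex_iff[OF noncollinear_rotate(2)[OF nc], of z x y]
    by (auto simp: bary_rotate[of B C A] bary_rotate[of C A B] add_ac)
  show "incenter A B C \<in> darboux_locus A B C"
    using sl ne[of a b c] add_pos_pos[OF add_pos_pos[OF sl(1,2)] sl(3)]
    by (intro mem_darboux_locus_cubic[OF nc, where x = 1 and y = 1 and z = 1])
      (simp_all add: incenter_bary[OF nc] a_def b_def c_def)
  show "excenter A B C \<in> darboux_locus A B C"
    using sl ne[of "- a" b c]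
    by (intro mem_darboux_locus_cubic[OF nc, where x = "-1" and y = 1 and z = 1])
      (simp_all add: excenter_bary[OF nc] a_def b_def c_def)
qed

lemma circumcenter_mem_darboux_locus:
  assumes nc: "\<not> collinear {A, B, C}"
  shows "circumcenter A B C \<in> darboux_locus A B C"
proof -
  define a b c where "a = dist B C" and "b = dist C A" and "c = dist A B"
  define N where "N = (a + b + c) * (b + c - a) * (c + a - b) * (a + b - c)"
  note cb = circumcenter_bary[OF nc, folded a_def b_def c_def, folded N_def]
  define x y z where "x = a * (b\<^sup>2 + c\<^sup>2 - a\<^sup>2)" and "y = b * (c\<^sup>2 + a\<^sup>2 - b\<^sup>2)" and "z = c * (a\<^sup>2 + b\<^sup>2 - c\<^sup>2)"
  have *: "a * x = a\<^sup>2 * (b\<^sup>2 + c\<^sup>2 - a\<^sup>2)" "b * y = b\<^sup>2 * (c\<^sup>2 + a\<^sup>2 - b\<^sup>2)" "c * z = c\<^sup>2 * (a\<^sup>2 + b\<^sup>2 - c\<^sup>2)"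
    by (simp_all add: x_def y_def z_def power2_eq_square)
  obtain R where R: "dist (circumcenter A B C) A = R" "dist (circumcenter A B C) B = R"
    "dist (circumcenter A B C) C = R"
    using dist_circumcenter[OF nc] .
  \<comment> \<open>At a vertex the common distance \<open>R\<close> would be 0 and the vertices
    would coincide.\<close>
  have ne: "circumcenter A B C \<notin> {A, B, C}"
    using R noncollinear_neq[OF nc] by auto
  \<comment> \<open>Here \<open>x\<close> is \<open>2 * a * b * c\<close> times the cosine of the
    angle at \<open>A\<close>, so \<open>x\<^sup>2 = 4 * a\<^sup>2 * b\<^sup>2 * c\<^sup>2 - N *
    a\<^sup>2\<close>, and cyclically. The factor \<open>- N\<close> can thus be split off.\<close>
  have diff: "y\<^sup>2 - z\<^sup>2 = - N * (b\<^sup>2 - c\<^sup>2)" "z\<^sup>2 - x\<^sup>2 = - N * (c\<^sup>2 - a\<^sup>2)" "x\<^sup>2 - y\<^sup>2 = - N * (a\<^sup>2 - b\<^sup>2)"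
    unfolding x_def y_def z_def N_def by algebra+
  have "(4 * a\<^sup>2 * (b\<^sup>2 + c\<^sup>2 - a\<^sup>2) - N) * b * c * x * (b\<^sup>2 - c\<^sup>2) +
      (4 * b\<^sup>2 * (c\<^sup>2 + a\<^sup>2 - b\<^sup>2) - N) * c * a * y * (c\<^sup>2 - a\<^sup>2) +
      (4 * c\<^sup>2 * (a\<^sup>2 + b\<^sup>2 - c\<^sup>2) - N) * a * b * z * (a\<^sup>2 - b\<^sup>2) = 0"
    unfolding x_def y_def z_def N_def by algebra
  then have "(4 * a\<^sup>2 * (b\<^sup>2 + c\<^sup>2 - a\<^sup>2) - N) * b * c * x * (y\<^sup>2 - z\<^sup>2) +
      (4 * b\<^sup>2 * (c\<^sup>2 + a\<^sup>2 - b\<^sup>2) - N) * c * a * y * (z\<^sup>2 - x\<^sup>2) +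
      (4 * c\<^sup>2 * (a\<^sup>2 + b\<^sup>2 - c\<^sup>2) - N) * a * b * z * (x\<^sup>2 - y\<^sup>2) = 0"
    unfolding diff by algebra
  then show ?thesis
    using cb ne
    by (intro mem_darboux_locus_cubic[OF nc, folded a_def b_def c_def, folded N_def, where x = x and y = y and z = z])
      (simp_all add: *)
qed

text \<open>Euler's inequality \<open>OI < R\<close> excludes the vertices.\<close>

lemma bevan_point_mem_darboux_locus:
  assumes nc: "\<not> collinear {A, B, C}"
  shows "bevan_point A B C \<in> darboux_locus A B C"
proof -
  define a b c where "a = dist B C" and "b = dist C A" and "c = dist A B"
  define N where "N = (a + b + c) * (b + c - a) * (c + a - b) * (a + b - c)"
  define M where "M = (b + c - a) * (c + a - b) * (a + b - c)"
  define x y z where "x = 2 * a * (b\<^sup>2 + c\<^sup>2 - a\<^sup>2) - M" and "y = 2 * b * (c\<^sup>2 + a\<^sup>2 - b\<^sup>2) - M"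
    and "z = 2 * c * (a\<^sup>2 + b\<^sup>2 - c\<^sup>2) - M"
  note V = bevan_point_bary[OF nc, folded a_def b_def c_def, folded M_def, folded x_def y_def z_def]
  have pos: "a > 0" "b > 0" "c > 0"
    using side_lengths[OF nc] by (simp_all add: a_def b_def c_def)
  obtain R where R: "dist (circumcenter A B C) A = R" "dist (circumcenter A B C) B = R"
    "dist (circumcenter A B C) C = R"
    using dist_circumcenter[OF nc] .
  have "(dist (circumcenter A B C) (bevan_point A B C))\<^sup>2 = (dist (circumcenter A B C) (incenter A B C))\<^sup>2"
    unfolding bevan_point_eq[OF nc] dist_norm by (simp add: scaleR_2 norm_minus_commute)
  also have "\<dots> = R\<^sup>2 - (a\<^sup>2 * b * c + b\<^sup>2 * c * a + c\<^sup>2 * a * b) / (a + b + c)\<^sup>2"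
    using dist_circumcenter_bary[OF _ R, of a b c] add_pos_pos[OF add_pos_pos[OF pos(1,2)] pos(3)] incenter_bary[OF nc]
    by (simp add: a_def b_def c_def)
  also have "\<dots> < R\<^sup>2"
    using pos by (simp add: add_pos_pos)
  finally have ne: "bevan_point A B C \<notin> {A, B, C}"
    using R by auto
  \<comment> \<open>Together with the products of two sides in the cubic, a common factor
    \<open>- 4 * N * a * b * c\<close> splits off and leaves the next identity.\<close>
  have diff: "y\<^sup>2 - z\<^sup>2 = - 4 * N * (a * (b - c))" "z\<^sup>2 - x\<^sup>2 = - 4 * N * (b * (c - a))"
    "x\<^sup>2 - y\<^sup>2 = - 4 * N * (c * (a - b))"
    unfolding x_def y_def z_def N_def M_def by algebra+
  have "(4 * a\<^sup>2 * (b\<^sup>2 + c\<^sup>2 - a\<^sup>2) - N) * x * (b - c) +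
      (4 * b\<^sup>2 * (c\<^sup>2 + a\<^sup>2 - b\<^sup>2) - N) * y * (c - a) +
      (4 * c\<^sup>2 * (a\<^sup>2 + b\<^sup>2 - c\<^sup>2) - N) * z * (a - b) = 0"
    unfolding x_def y_def z_def N_def M_def by algebra
  then have "(4 * a\<^sup>2 * (b\<^sup>2 + c\<^sup>2 - a\<^sup>2) - N) * b * c * x * (y\<^sup>2 - z\<^sup>2) +
      (4 * b\<^sup>2 * (c\<^sup>2 + a\<^sup>2 - b\<^sup>2) - N) * c * a * y * (z\<^sup>2 - x\<^sup>2) +
      (4 * c\<^sup>2 * (a\<^sup>2 + b\<^sup>2 - c\<^sup>2) - N) * a * b * z * (x\<^sup>2 - y\<^sup>2) = 0"
    unfolding diff by algebra
  then show ?thesis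
    using V V(3)[THEN dual_order.strict_implies_not_eq] ne
    by (intro mem_darboux_locus_cubic[OF nc, folded a_def b_def c_def, folded N_def, where x = x and y = y and z = z])
      simp_all
qed

theorem theorem3:
  fixes H1 H2 H3 A B C :: point and K :: "point set"
  assumes "\<not> collinear {H1, H2, H3}"
    and "is_excentral_triangle A B C H1 H2 H3"
    and "is_darboux_cubic H1 H2 H3 K"
  shows "H1 = altitude_foot A B C \<and> H2 = altitude_foot B C A \<and> H3 = altitude_foot C A B \<and>
    {A, B, C, H1, H2, H3, orthocenter A B C, nine_point_center A B C, circumcenter A B C} \<subseteq> K"
proof -
  note nc = assms(1) noncollinear_rotate[OF assms(1)]
  have ABC: "A = excenter H1 H2 H3" "B = excenter H2 H3 H1" "C = excenter H3 H1 H2"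
    using assms(2) by (simp_all add: is_excentral_triangle_def)
  have centers: "orthocenter A B C = incenter H1 H2 H3" "nine_point_center A B C = circumcenter H1 H2 H3"
    "circumcenter A B C = bevan_point H1 H2 H3"
    using excentral_orthocenter[OF nc(1)] excentral_nine_point_center[OF nc(1)]
    by (simp_all add: ABC bevan_point_def)
  have feet: "altitude_foot A B C = H1" "altitude_foot B C A = H2" "altitude_foot C A B = H3"
    using excentral_altitude(1)[OF nc(1)] excentral_altitude(1)[OF nc(2)] excentral_altitude(1)[OF nc(3)]
    by (simp_all add: ABC)
  have "{H1, H2, H3, A, B, C, incenter H1 H2 H3, circumcenter H1 H2 H3, bevan_point H1 H2 H3} \<subseteq> K"
  \<comment> \<open>For the locus each point needs its own argument; for a cubic through the
    defining points the inclusion is part of the definition.\<close>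
  proof (cases "K = darboux_locus H1 H2 H3")
    case True
    \<comment> \<open>Rotation yields the remaining vertices and excenters from the lemmas about the
      first one.\<close>
    have "darboux_locus H2 H3 H1 = K" "darboux_locus H3 H1 H2 = K"
      by (simp_all add: True darboux_locus_rotate[of H2 H3 H1] darboux_locus_rotate[of H3 H1 H2])
    then show ?thesis
      using vertex_mem_darboux_locus[OF nc(1)] vertex_mem_darboux_locus[OF nc(2)] vertex_mem_darboux_locus[OF nc(3)]
        tritangent_centers_mem_darboux_locus[OF nc(1)] tritangent_centers_mem_darboux_locus(2)[OF nc(2)]
        tritangent_centers_mem_darboux_locus(2)[OF nc(3)] circumcenter_mem_darboux_locus[OF nc(1)]
        bevan_point_mem_darboux_locus[OF nc(1)]
      by (simp add: True ABC)
  next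
    case False
    then show ?thesis
      using assms(3) by (simp add: is_darboux_cubic_def is_cubic_through_darboux_points_def ABC)
  qed
  then show ?thesis
    by (simp add: centers feet)
qed

end
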